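(* Let $\lambda>0$, $\mu_0>0$, $a>0$, $\gamma>1$, $G=\mu_0/\lambda$, $p(\rho)=a\rho^\gamma$. Let $(\rho,\mathbf u,\mathbf A,\mathbf F)$ be a (local in time, $C^1$) solution on $[0,T]\times\mathbb R^3$ of $$ \begin{cases} \rho_t + \nabla \cdot (\rho \mathbf{u}) = 0, \\ \rho \mathbf{u}_t + \rho \mathbf{u} \cdot \nabla \mathbf{u} + \nabla p(\rho) = \nabla \cdot \big(\rho G(\mathbf{F} \mathbf{A} \mathbf{F}^T - \mathbf{I}_3)\big), \\ \lambda (\mathbf{A}_t + \mathbf{u} \cdot \nabla \mathbf{A}) + \mathbf{A} = \mathbf{F}^{-1} \mathbf{F}^{-T}, \\ \mathbf{F}_t + \mathbf{u} \cdot \nabla \mathbf{F} = (\nabla \mathbf{u}) \mathbf{F}, \end{cases} $$ with initial data satisfying the standing assumptions in the context, and let $\mathbf T=\rho G(\mathbf F\mathbf A\mathbf F^T-\mathbf I_3)$, which satisfies $$ \lambda \left( \mathbf{T}_t + \mathbf{u} \cdot \nabla \mathbf{T} - (\nabla \mathbf{u}) \mathbf{T} - \mathbf{T} (\nabla \mathbf{u})^T + (\nabla \cdot \mathbf{u}) \mathbf{T} \right) + \mathbf{T} = \mu_0 \rho \left(\nabla \mathbf{u}+(\nabla\mathbf u)^T\right). $$ Then $$ \frac{d}{dt} \int_{\mathbb{R}^3} \left( \frac{\rho}{2} |\mathbf{u}|^2 + \frac{a}{\gamma-1} \big(\rho^\gamma - 1 - \gamma(\rho - 1)\big) + \frac{\mu_0}{\lambda}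 (\rho \ln \rho - \rho + 1) + \frac{\mathrm{tr}(\mathbf{T})}{2} \right) d\mathbf x + \frac{1}{\lambda} \int_{\mathbb{R}^3} \frac{\mathrm{tr}(\mathbf{T})}{2}\, d\mathbf x = 0 . $$
   Context: The unknowns are functions of $(t,\mathbf x)\in[0,T]\times\mathbb R^3$: density $\rho>0$, velocity $\mathbf u\in\mathbb R^3$, symmetric positive definite $3\times3$ matrix $\mathbf A$, and invertible $3\times 3$ deformation gradient $\mathbf F$. $\mathbf I_3$ is the $3\times3$ identity matrix, $(\nabla\mathbf u)_{ij}=\partial_j u_i$, the divergence of a (symmetric) matrix field is taken row-wise, and $\mathbf F^{-T}=(\mathbf F^{-1})^T$. The number $T>0$ is a time, $\mathbf T$ (bold) is the stress tensor. Standing assumptions on the initial data $(\rho_0,\mathbf u_0,\mathbf A_0,\mathbf F_0)$ (background density normalized to $\bar\rho=1$): (1) $(\rho_0-1,\mathbf u_0,\mathbf A_0-\mathbf I_3,\mathbf F_0-\mathbf I_3)$ is supported in $B_R=\{|\mathbf x|\le R\}$ for some $R>0$; (2) $\int_{\mathbb R^3}(\rho_0-1)\,d\mathbf x\ge0$; (3) $\mathrm{tr}(\mathbf T_0)\ge0$, where $\mathbf T_0=\rho_0G(\mathbf F_0\mathbf A_0\mathbf F_0^T-\mathbf I_3)$. Finite propagation speed (known property of this hyperbolic system, taken as given): there is a constant $\sigma>0$ such that $(\rho-1,\mathbf u,\mathbf A-\mathbf I_3,\mathbf F-\mathbf I_3)(\cdot,t)=(0,0,0,0)$ on $\{|\mathbf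 x|>R+\sigma t\}$ for all $0\le t\le T$. *)

theory Defs
  imports "HOL-Analysis.Analysis"
begin

text \<open>
  A field is a function \<open>f t x\<close> of a time and a point of \<open>real^3\<close>.  \<open>C1_slab T f\<close> says that
  it is \<open>C\<^sup>1\<close> on the closed slab: Frechet derivatives are taken within the slab (hence one-sided
  in time at both ends) and depend continuously, in operator norm, on the point of the slab.
\<close>

definition C1_slab :: "real \<Rightarrow> (real \<Rightarrow> real^3 \<Rightarrow> 'b::real_normed_vector) \<Rightarrow> bool" where
  "C1_slab T f \<longleftrightarrow>
     (\<exists>f' :: real \<times> (real^3) \<Rightarrow> (real \<times> (real^3)) \<Rightarrow>\<^sub>L 'b.
        continuous_on ({0..T} \<times> UNIV) f' \<and>
        (\<forall>z \<in> {0..T} \<times> UNIV.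
           ((\<lambda>(t, x). f t x) has_derivative blinfun_apply (f' z)) (at z within {0..T} \<times> UNIV)))"

text \<open>Time derivative on \<open>{0..T}\<close>, one-sided at \<open>0\<close> and \<open>T\<close>.\<close>

definition dt :: "real \<Rightarrow> (real \<Rightarrow> real^3 \<Rightarrow> 'b::real_normed_vector) \<Rightarrow> real \<Rightarrow> real^3 \<Rightarrow> 'b" where
  "dt T f t x = vector_derivative (\<lambda>s. f s x) (at t within {0..T})"

definition pd :: "3 \<Rightarrow> (real^3 \<Rightarrow> 'b::real_normed_vector) \<Rightarrow> real^3 \<Rightarrow> 'b" where
  "pd j g x = frechet_derivative g (at x) (axis j 1)"

definition grad :: "(real^3 \<Rightarrow> real) \<Rightarrow> real^3 \<Rightarrow> real^3" where
  "grad g x = (\<chi> j. pd j g x)"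

text \<open>Rows index components and columns index derivatives: entry \<open>i, j\<close> is \<open>\<partial>\<^sub>j v\<^sub>i\<close>.\<close>

abbreviation grad_vec :: "(real^3 \<Rightarrow> real^3) \<Rightarrow> real^3 \<Rightarrow> real^3^3" where
  "grad_vec v x \<equiv> jacobian v (at x)"

definition dvg :: "(real^3 \<Rightarrow> real^3) \<Rightarrow> real^3 \<Rightarrow> real" where
  "dvg v x = (\<Sum>j\<in>UNIV. pd j (\<lambda>y. v y $ j) x)"

definition dvg_mat :: "(real^3 \<Rightarrow> real^3^3) \<Rightarrow> real^3 \<Rightarrow> real^3" where
  "dvg_mat M x = (\<chi> i. dvg (\<lambda>y. M y $ i) x)"

text \<open>The operator \<open>v \<cdot> \<nabla>\<close>, acting componentwise on vector and matrix fields.\<close>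

definition advect :: "(real^3 \<Rightarrow> real^3) \<Rightarrow> (real^3 \<Rightarrow> 'b::real_normed_vector) \<Rightarrow> real^3 \<Rightarrow> 'b" where
  "advect v g x = (\<Sum>j\<in>UNIV. (v x $ j) *\<^sub>R pd j g x)"

definition sym_pos_def :: "real^3^3 \<Rightarrow> bool" where
  "sym_pos_def M \<longleftrightarrow> transpose M = M \<and> (\<forall>v. v \<noteq> 0 \<longrightarrow> v \<bullet> (M *v v) > 0)"

definition stress :: "real \<Rightarrow> real \<Rightarrow> real^3^3 \<Rightarrow> real^3^3 \<Rightarrow> real^3^3" where
  "stress G r A F = (r * G) *\<^sub>R (F ** A ** transpose F - mat 1)"

definition solution ::
  "real \<Rightarrow> real \<Rightarrow> real \<Rightarrow> real \<Rightarrow> real \<Rightarrow> (real \<Rightarrow> real^3 \<Rightarrow> real) \<Rightarrow> (real \<Rightarrow> real^3 \<Rightarrow> real^3) \<Rightarrow>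
   (real \<Rightarrow> real^3 \<Rightarrow> real^3^3) \<Rightarrow> (real \<Rightarrow> real^3 \<Rightarrow> real^3^3) \<Rightarrow> bool" where
  "solution lam \<mu>0 a \<gamma> T \<rho> u A F \<longleftrightarrow>
     C1_slab T \<rho> \<and> C1_slab T u \<and> C1_slab T A \<and> C1_slab T F \<and>
     (\<forall>t\<in>{0..T}. \<forall>x.
        \<rho> t x > 0 \<and> sym_pos_def (A t x) \<and> invertible (F t x) \<and>
        dt T \<rho> t x + dvg (\<lambda>y. \<rho> t y *\<^sub>R u t y) x = 0 \<and>
        \<rho> t x *\<^sub>R dt T u t x + \<rho> t x *\<^sub>R advect (u t) (u t) x + grad (\<lambda>y. a * \<rho> t y powr \<gamma>) x
          = dvg_mat (\<lambda>y. stress (\<mu>0 / lam) (\<rho> t y) (A t y) (F t y)) x \<and>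
        lam *\<^sub>R (dt T A t x + advect (u t) (A t) x) + A t x
          = matrix_inv (F t x) ** transpose (matrix_inv (F t x)) \<and>
        dt T F t x + advect (u t) (F t) x = grad_vec (u t) x ** F t x)"

definition initial_data_assms ::
  "real \<Rightarrow> real \<Rightarrow> (real^3 \<Rightarrow> real) \<Rightarrow> (real^3 \<Rightarrow> real^3) \<Rightarrow> (real^3 \<Rightarrow> real^3^3) \<Rightarrow>
   (real^3 \<Rightarrow> real^3^3) \<Rightarrow> bool" where
  "initial_data_assms G R \<rho>0 u0 A0 F0 \<longleftrightarrow>
     closure {x. (\<rho>0 x - 1, u0 x, A0 x - mat 1, F0 x - mat 1) \<noteq> 0} \<subseteq> cball 0 R \<and>
     (LINT x|lborel. \<rho>0 x - 1) \<ge> 0 \<and>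
     (\<forall>x. trace (stress G (\<rho>0 x) (A0 x) (F0 x)) \<ge> 0)"

definition finite_propagation ::
  "real \<Rightarrow> real \<Rightarrow> real \<Rightarrow> (real \<Rightarrow> real^3 \<Rightarrow> real) \<Rightarrow> (real \<Rightarrow> real^3 \<Rightarrow> real^3) \<Rightarrow>
   (real \<Rightarrow> real^3 \<Rightarrow> real^3^3) \<Rightarrow> (real \<Rightarrow> real^3 \<Rightarrow> real^3^3) \<Rightarrow> bool" where
  "finite_propagation R \<sigma> T \<rho> u A F \<longleftrightarrow>
     (\<forall>t\<in>{0..T}. \<forall>x. norm x > R + \<sigma> * t \<longrightarrow>
        (\<rho> t x - 1, u t x, A t x - mat 1, F t x - mat 1) = 0)"

definition energy_density ::
  "real \<Rightarrow> real \<Rightarrow> real \<Rightarrow> real \<Rightarrow> real \<Rightarrow> real^3 \<Rightarrow> real^3^3 \<Rightarrow> real" where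
  "energy_density lam \<mu>0 a \<gamma> r v S =
     r / 2 * (norm v)\<^sup>2
     + a / (\<gamma> - 1) * (r powr \<gamma> - 1 - \<gamma> * (r - 1))
     + \<mu>0 / lam * (r * ln r - r + 1)
     + trace S / 2"

end

theory Submission
  imports Defs
begin

text \<open>
  Along the flow every field changes at the rate of its total space-time derivative in the direction
  \<open>(1, u)\<close>, so the equation for \<open>T = \<rho> G (F A F\<^sup>T - I)\<close> is the product rule combined with
  \<open>F (F\<^sup>-\<^sup>1 F\<^sup>-\<^sup>T) F\<^sup>T = I\<close>.  Half its trace, the momentum equation tested with \<open>u\<close> and the
  mass equation then add up to the pointwise law \<open>\<partial>\<^sub>t e + div W = - tr T / (2 \<lambda>)\<close>, where \<open>e\<close> is the
  energy density and \<open>W\<close> its flux.  By finite propagation \<open>e\<close> and \<open>W\<close> vanish outside a fixed ball, so one may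
  differentiate under the integral, and the divergence integrates to zero.
\<close>

subsection \<open>Calculus on the slab\<close>

text \<open>In finite dimension, continuity of each directional derivative amounts to continuity of the
  derivative in operator norm.\<close>

definition slab_derivative ::
  "real \<Rightarrow> (real \<Rightarrow> real^3 \<Rightarrow> 'b::real_normed_vector) \<Rightarrow>
   (real \<Rightarrow> real^3 \<Rightarrow> real \<times> (real^3) \<Rightarrow> 'b) \<Rightarrow> bool" where
  "slab_derivative T f f' \<longleftrightarrow>
     (\<forall>t\<in>{0..T}. \<forall>x. ((\<lambda>(t, x). f t x) has_derivative f' t x) (at (t, x) within {0..T} \<times> UNIV)) \<and>
     (\<forall>h. continuous_on ({0..T} \<times> UNIV) (\<lambda>(t, x). f' t x h))"

lemma slab_derivativeI:
  assumes "\<And>t x. t \<in> {0..T} \<Longrightarrow>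
      ((\<lambda>z. f (fst z) (snd z)) has_derivative f' t x) (at (t, x) within {0..T} \<times> UNIV)"
    and "\<And>h. continuous_on ({0..T} \<times> UNIV) (\<lambda>z. f' (fst z) (snd z) h)"
  shows "slab_derivative T f f'"
  using assms unfolding slab_derivative_def split_def by simp

lemma slab_derivativeD:
  assumes "slab_derivative T f f'"
  shows "t \<in> {0..T} \<Longrightarrow>
      ((\<lambda>z. f (fst z) (snd z)) has_derivative f' t x) (at (t, x) within {0..T} \<times> UNIV)"
    and "continuous_on ({0..T} \<times> UNIV) (\<lambda>z. f' (fst z) (snd z) h)"
  using assms by (simp_all add: slab_derivative_def split_def del: split_paired_All)

text \<open>Evaluation at a fixed direction is continuous in operator norm, so the bundled
  derivative can be traded for a plain function. The rules below then need not build a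
  \<open>blinfun\<close> for each product or composition.\<close>

lemma C1_slab_obtain:
  assumes "C1_slab T f"
  obtains f' where "slab_derivative T f f'"
proof -
  obtain f' :: "real \<times> (real^3) \<Rightarrow> (real \<times> (real^3)) \<Rightarrow>\<^sub>L 'a" where f':
    "continuous_on ({0..T} \<times> UNIV) f'"
    "\<forall>z \<in> {0..T} \<times> UNIV.
      ((\<lambda>(t, x). f t x) has_derivative blinfun_apply (f' z)) (at z within {0..T} \<times> UNIV)"
    using assms unfolding C1_slab_def by metis
  have "slab_derivative T f (\<lambda>t x. blinfun_apply (f' (t, x)))"
  proof (rule slab_derivativeI)
    show "continuous_on ({0..T} \<times> UNIV) (\<lambda>z. blinfun_apply (f' (fst z, snd z)) h)" for h
      using f'(1) by (simp add: continuous_intros)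
  qed (use f'(2) in \<open>simp add: split_def\<close>)
  then show thesis by (rule that)
qed

lemma slab_derivative_continuous_on:
  assumes "slab_derivative T f f'"
  shows "continuous_on ({0..T} \<times> UNIV) (\<lambda>z. f (fst z) (snd z))"
  by (rule has_derivative_continuous_on[where f' = "\<lambda>z. f' (fst z) (snd z)"])
     (use slab_derivativeD(1)[OF assms] in auto)

lemma slab_derivative_continuous_space:
  assumes "slab_derivative T f f'" and "t \<in> {0..T}"
  shows "continuous_on UNIV (\<lambda>x. f' t x h)"
proof -
  have "continuous_on UNIV (\<lambda>x. f' (fst (t, x)) (snd (t, x)) h)"
    by (rule continuous_on_compose2[OF slab_derivativeD(2)[OF assms(1)]])
       (use assms(2) in \<open>auto intro!: continuous_intros\<close>)
  then show ?thesis by simp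
qed

lemma slab_derivative_linear:
  assumes "slab_derivative T f f'" and "t \<in> {0..T}"
  shows "linear (f' t x)"
  using slab_derivativeD(1)[OF assms] by (intro bounded_linear.linear has_derivative_bounded_linear)

lemma slab_derivative_const: "slab_derivative T (\<lambda>t x. c) (\<lambda>t x h. 0)"
  by (rule slab_derivativeI) auto

lemma slab_derivative_bounded_linear:
  assumes L: "bounded_linear L" and f: "slab_derivative T f f'"
  shows "slab_derivative T (\<lambda>t x. L (f t x)) (\<lambda>t x h. L (f' t x h))"
  by (rule slab_derivativeI)
     (intro bounded_linear.has_derivative[OF L] bounded_linear.continuous_on[OF L]
        slab_derivativeD[OF f] | assumption)+

text \<open>One product rule serves real multiplication, scaling, inner product, matrix product and
  matrix-vector product.\<close>

lemma slab_derivative_bounded_bilinear: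
  assumes B: "bounded_bilinear B" and f: "slab_derivative T f f'" and g: "slab_derivative T g g'"
  shows "slab_derivative T (\<lambda>t x. B (f t x) (g t x))
     (\<lambda>t x h. B (f t x) (g' t x h) + B (f' t x h) (g t x))"
proof (rule slab_derivativeI)
  fix t x assume t: "t \<in> {0..T}"
  show "((\<lambda>z. B (f (fst z) (snd z)) (g (fst z) (snd z))) has_derivative
       (\<lambda>h. B (f t x) (g' t x h) + B (f' t x h) (g t x))) (at (t, x) within {0..T} \<times> UNIV)"
    using bounded_bilinear.FDERIV[OF B slab_derivativeD(1)[OF f t] slab_derivativeD(1)[OF g t]]
    by simp
next
  show "continuous_on ({0..T} \<times> UNIV) (\<lambda>z. B (f (fst z) (snd z)) (g' (fst z) (snd z) h) +
      B (f' (fst z) (snd z) h) (g (fst z) (snd z)))" for h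
    by (intro continuous_on_add bounded_bilinear.continuous_on[OF B]
        slab_derivative_continuous_on[OF f] slab_derivative_continuous_on[OF g]
        slab_derivativeD(2)[OF f] slab_derivativeD(2)[OF g])
qed

lemma slab_derivative_add:
  assumes f: "slab_derivative T f f'" and g: "slab_derivative T g g'"
  shows "slab_derivative T (\<lambda>t x. f t x + g t x) (\<lambda>t x h. f' t x h + g' t x h)"
  by (rule slab_derivativeI)
     (intro continuous_on_add has_derivative_add slab_derivativeD[OF f] slab_derivativeD[OF g]
      | assumption)+

lemma slab_derivative_diff:
  assumes f: "slab_derivative T f f'" and g: "slab_derivative T g g'"
  shows "slab_derivative T (\<lambda>t x. f t x - g t x) (\<lambda>t x h. f' t x h - g' t x h)"
  by (rule slab_derivativeI)
     (intro continuous_on_diff has_derivative_diff slab_derivativeD[OF f] slab_derivativeD[OF g]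
      | assumption)+

text \<open>The outer function need be smooth only on a set \<open>S\<close> containing the values
  of \<open>f\<close>. Powers and logarithms of the density are handled with
  \<open>S = {0<..}\<close>.\<close>

lemma slab_derivative_compose_real:
  fixes \<phi> \<phi>' :: "real \<Rightarrow> real"
  assumes f: "slab_derivative T f f'" and S: "\<And>t x. t \<in> {0..T} \<Longrightarrow> f t x \<in> S"
    and \<phi>: "\<And>r. r \<in> S \<Longrightarrow> (\<phi> has_real_derivative \<phi>' r) (at r)" and cont: "continuous_on S \<phi>'"
  shows "slab_derivative T (\<lambda>t x. \<phi> (f t x)) (\<lambda>t x h. \<phi>' (f t x) * f' t x h)"
proof (rule slab_derivativeI)
  fix t x assume t: "t \<in> {0..T}"
  have "(\<phi> has_derivative (*) (\<phi>' (f t x))) (at (f t x))"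
    using \<phi>[OF S] t by (auto simp: has_field_derivative_def)
  then show "((\<lambda>z. \<phi> (f (fst z) (snd z))) has_derivative (\<lambda>h. \<phi>' (f t x) * f' t x h))
    (at (t, x) within {0..T} \<times> UNIV)"
    using has_derivative_compose[OF slab_derivativeD(1)[OF f t]] by simp
next
  fix h
  have "continuous_on ({0..T} \<times> UNIV) (\<lambda>z. \<phi>' (f (fst z) (snd z)))"
    by (rule continuous_on_compose2[OF cont slab_derivative_continuous_on[OF f]]) (use S in auto)
  then show "continuous_on ({0..T} \<times> UNIV) (\<lambda>z. \<phi>' (f (fst z) (snd z)) * f' (fst z) (snd z) h)"
    using slab_derivativeD(2)[OF f] by (rule continuous_on_mult)
qed

section \<open>Time and space derivatives read off the slab derivative\<close>

lemma slab_derivative_time: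
  assumes f: "slab_derivative T f f'" and t: "t \<in> {0..T}"
  shows "((\<lambda>s. f s x) has_vector_derivative f' t x (1, 0)) (at t within {0..T})"
proof -
  \<comment> \<open>The segment \<open>s \<mapsto> (s, x)\<close> stays in the slab for
    \<open>s\<close> in \<open>{0..T}\<close>, so the chain rule gives a derivative that is
    one-sided at the end points.\<close>
  have "((\<lambda>s. (s, x)) has_derivative (\<lambda>h. (h, 0))) (at t within {0..T})"
    by (auto intro!: derivative_eq_intros)
  from has_derivative_in_compose[OF this, of "\<lambda>z. f (fst z) (snd z)" "f' t x"]
  have "((\<lambda>s. f s x) has_derivative (\<lambda>h. f' t x (h, 0))) (at t within {0..T})"
    using has_derivative_subset[OF slab_derivativeD(1)[OF f t], of "(\<lambda>s. (s, x)) ` {0..T}" x]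
    by auto
  moreover have "(\<lambda>h. f' t x (h, 0)) = (\<lambda>h. h *\<^sub>R f' t x (1, 0))"
  proof
    fix h :: real
    have "(h, 0) = h *\<^sub>R (1, 0 :: real^3)" by simp
    then show "f' t x (h, 0) = h *\<^sub>R f' t x (1, 0)"
      by (simp only: linear_scale[OF slab_derivative_linear[OF f t]])
  qed
  ultimately show ?thesis by (simp only: has_vector_derivative_def)
qed

text \<open>A whole time slice lies in the slab, also for \<open>t = 0\<close> and
  \<open>t = T\<close>; hence the spatial derivative is unrestricted at every time.\<close>

lemma slab_derivative_space:
  assumes f: "slab_derivative T f f'" and t: "t \<in> {0..T}"
  shows "(f t has_derivative (\<lambda>h. f' t x (0, h))) (at x)"
proof -
  have "((\<lambda>y. (t, y)) has_derivative (\<lambda>h. (0, h))) (at x)"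
    by (auto intro!: derivative_eq_intros)
  moreover have "((\<lambda>z. f (fst z) (snd z)) has_derivative f' t x) (at (t, x) within range (\<lambda>y. (t, y)))"
    by (rule has_derivative_subset[OF slab_derivativeD(1)[OF f t]]) (use t in auto)
  ultimately show ?thesis
    using has_derivative_in_compose[of "\<lambda>y. (t, y)" "\<lambda>h. (0, h)" x UNIV
        "\<lambda>z. f (fst z) (snd z)" "f' t x"] by (simp add: o_def)
qed

text \<open>Since \<open>T > 0\<close>, derivatives within \<open>{0..T}\<close> are unique, so
  \<open>vector_derivative\<close> picks the value found above.\<close>

lemma dt_eq:
  assumes "slab_derivative T f f'" and "t \<in> {0..T}" and "T > 0"
  shows "dt T f t x = f' t x (1, 0)"
  using vector_derivative_within_cbox[OF \<open>T > 0\<close>, of t "\<lambda>s. f s x"]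
    slab_derivative_time[OF assms(1,2)] assms(2)
  unfolding dt_def by simp

lemma pd_eq:
  assumes "slab_derivative T f f'" and "t \<in> {0..T}"
  shows "pd j (f t) x = f' t x (0, axis j 1)"
  unfolding pd_def
  by (simp add: frechet_derivative_at[OF slab_derivative_space[OF assms], symmetric])

text \<open>This passes from the Lebesgue integral over the whole space to the gauge integral over a
  box, for which the Leibniz rule is available.\<close>

lemma integral_compact_support:
  fixes f :: "real^3 \<Rightarrow> real"
  assumes cont: "continuous_on UNIV f" and supp: "\<And>x. x \<notin> cbox a b \<Longrightarrow> f x = 0"
  shows "integrable lborel f" and "(LINT x|lborel. f x) = integral (cbox a b) f"
proof -
  have eq: "(\<lambda>x. indicator (cbox a b) x *\<^sub>R f x) = f"
  proof
    show "indicator (cbox a b) x *\<^sub>R f x = f x" for x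
      using supp[of x] by (cases "x \<in> cbox a b") auto
  qed
  have "integrable lborel (\<lambda>x. indicator (cbox a b) x *\<^sub>R f x)"
    by (rule borel_integrable_compact) (use cont continuous_on_subset in auto)
  then show int: "integrable lborel f" by (simp only: eq)
  have "(LINT x|lborel. f x) = integral UNIV f"
    using int by (rule integral_lborel[symmetric])
  also have "\<dots> = integral (cbox a b) f"
    using supp by (intro integral_spike_set) (auto intro: negligible_subset[OF negligible_empty])
  finally show "(LINT x|lborel. f x) = integral (cbox a b) f" .
qed

section \<open>Matrix operations as bounded linear and bilinear maps\<close>

lemma bounded_bilinear_matrix_mult:
  "bounded_bilinear ((**) :: real^'n^'m \<Rightarrow> real^'k^'n \<Rightarrow> real^'k^'m)"
  unfolding bilinear_conv_bounded_bilinear[symmetric] bilinear_def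
  by (intro conjI allI linearI) (simp_all add: matrix_matrix_mult_def vec_eq_iff sum.distrib
      sum_distrib_left distrib_left distrib_right mult_ac)

lemma bounded_bilinear_matrix_vector_mult:
  "bounded_bilinear ((*v) :: real^'n^'m \<Rightarrow> real^'n \<Rightarrow> real^'m)"
  unfolding bilinear_conv_bounded_bilinear[symmetric] bilinear_def
  by (intro conjI allI linearI) (simp_all add: matrix_vector_mult_def vec_eq_iff sum.distrib
      sum_distrib_left distrib_left distrib_right mult_ac)

lemma bounded_linear_transpose: "bounded_linear (transpose :: real^'n^'m \<Rightarrow> real^'m^'n)"
  by (intro linear_conv_bounded_linear[THEN iffD1] linearI) (simp_all add: transpose_def vec_eq_iff)

lemma bounded_linear_trace: "bounded_linear (trace :: real^'n^'n \<Rightarrow> real)"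
  by (intro linear_conv_bounded_linear[THEN iffD1] linearI)
     (simp_all add: trace_def sum.distrib sum_distrib_left)

subsection \<open>Integrals of compactly supported fields\<close>

text \<open>Supports are bounded by balls, whereas integrals are taken over boxes; this box contains
  the ball.\<close>

lemma outside_ball_cbox:
  obtains a where "\<And>x :: real^3. x \<notin> cbox (- a) a \<Longrightarrow> M < norm x"
proof -
  obtain a :: "real^3" where "cball 0 M \<subseteq> cbox (- a) a"
    using bounded_subset_cbox_symmetric[OF bounded_cball] by blast
  then show thesis by (intro that[of a]) (force simp: not_le[symmetric])
qed

text \<open>The time derivative vanishes outside the same ball as \<open>f\<close>, so both
  integrals reduce to one fixed box, where the Leibniz rule applies up to the ends of the time
  interval.\<close>

lemma has_real_derivative_integral_slab:
  fixes f :: "real \<Rightarrow> real^3 \<Rightarrow> real"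
  assumes f: "slab_derivative T f f'" and T: "T > 0"
    and supp: "\<forall>t\<in>{0..T}. \<forall>x. M < norm x \<longrightarrow> f t x = 0"
    and t: "t \<in> {0..T}"
  shows "integrable lborel (f t)" and "integrable lborel (\<lambda>x. f' t x (1, 0))"
    and "((\<lambda>s. LINT x|lborel. f s x) has_real_derivative (LINT x|lborel. f' t x (1, 0)))
           (at t within {0..T})"
proof -
  obtain a :: "real^3" where a: "\<And>x. x \<notin> cbox (- a) a \<Longrightarrow> M < norm x"
    using outside_ball_cbox[of M] by metis
  have cont: "continuous_on UNIV (f s)" if "s \<in> {0..T}" for s
    using slab_derivative_space[OF f that] by (intro has_derivative_continuous_on) auto
  have cont': "continuous_on UNIV (\<lambda>x. f' t x (1, 0))"
    by (rule slab_derivative_continuous_space[OF f t])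
  \<comment> \<open>For such \<open>x\<close> the function \<open>s \<mapsto> f s x\<close> is zero
    on all of \<open>{0..T}\<close>; uniqueness of the one-sided derivative does the rest.\<close>
  have supp': "f' t x (1, 0) = 0" if "M < norm x" for x
  proof -
    have "((\<lambda>s. f s x) has_vector_derivative 0) (at t within {0..T})"
      using has_vector_derivative_const
      by (rule has_vector_derivative_transform[rotated 2]) (use t supp that in auto)
    from vector_derivative_unique_within_closed_interval[OF T, of t, unfolded cbox_interval,
        OF t slab_derivative_time[OF f t] this]
    show ?thesis .
  qed
  show "integrable lborel (f t)"
    using supp t a by (intro integral_compact_support(1)[OF cont[OF t]]) blast
  show "integrable lborel (\<lambda>x. f' t x (1, 0))"
    using supp'[OF a] by (rule integral_compact_support(1)[OF cont'])
  have int: "(LINT x|lborel. f s x) = integral (cbox (- a) a) (f s)" if "s \<in> {0..T}" for s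
    using supp that a by (intro integral_compact_support(2)[OF cont[OF that]]) blast
  have int': "(LINT x|lborel. f' t x (1, 0)) = integral (cbox (- a) a) (\<lambda>x. f' t x (1, 0))"
    using supp'[OF a] by (rule integral_compact_support(2)[OF cont'])
  have "((\<lambda>s. integral (cbox (- a) a) (f s)) has_real_derivative
      integral (cbox (- a) a) (\<lambda>x. f' t x (1, 0))) (at t within {0..T})"
  proof (rule leibniz_rule_field_derivative[where fx = "\<lambda>s x. f' s x (1, 0)"])
    show "((\<lambda>s. f s x) has_real_derivative f' s x (1, 0)) (at s within {0..T})"
      if "s \<in> {0..T}" for s x
      using slab_derivative_time[OF f that]
      by (simp add: has_real_derivative_iff_has_vector_derivative)
    show "f s integrable_on cbox (- a) a" if "s \<in> {0..T}" for s
      using cont[OF that] by (intro integrable_continuous) (rule continuous_on_subset, auto)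
    show "continuous_on ({0..T} \<times> cbox (- a) a) (\<lambda>(s, x). f' s x (1, 0))"
      unfolding split_def by (rule continuous_on_subset[OF slab_derivativeD(2)[OF f]]) auto
  qed (use t in auto)
  then show "((\<lambda>s. LINT x|lborel. f s x) has_real_derivative (LINT x|lborel. f' t x (1, 0)))
           (at t within {0..T})"
    unfolding int' has_field_derivative_def
    by (rule has_derivative_transform[rotated 2]) (use int t in auto)
qed

lemma integral_lborel_translation:
  fixes g :: "real^3 \<Rightarrow> real"
  assumes "continuous_on UNIV g"
  shows "(LINT x|lborel. g (c + x)) = (LINT x|lborel. g x)"
proof -
  have "(LINT x|lborel. g x) = (LINT x|distr lborel borel ((+) c). g x)"
    by (simp add: lborel_distr_plus)
  also have "\<dots> = (LINT x|lborel. g (c + x))"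
    by (rule integral_distr) (auto intro: borel_measurable_continuous_onI[OF assms])
  finally show ?thesis ..
qed

text \<open>The integral of a translate \<open>g (s *\<^sub>R b + x)\<close> does not depend on \<open>s\<close>; differentiate it at
  \<open>s = 0\<close>.\<close>

lemma integral_directional_derivative_eq_0:
  fixes g :: "real^3 \<Rightarrow> real"
  assumes g: "\<And>x. (g has_derivative g' x) (at x)"
    and cont: "\<And>h. continuous_on UNIV (\<lambda>x. g' x h)"
    and supp: "\<And>x. M < norm x \<Longrightarrow> g x = 0"
  shows "integrable lborel (\<lambda>x. g' x b)" and "(LINT x|lborel. g' x b) = 0"
proof -
  let ?k = "\<lambda>s x. g (s *\<^sub>R b + x)"
  \<comment> \<open>The shift parameter plays the role of time on a slab of length 1.\<close>
  have k: "slab_derivative 1 ?k (\<lambda>s x h. g' (s *\<^sub>R b + x) (fst h *\<^sub>R b + snd h))"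
  proof (rule slab_derivativeI)
    fix s x
    have "((\<lambda>z. fst z *\<^sub>R b + snd z) has_derivative (\<lambda>h. fst h *\<^sub>R b + snd h))
      (at (s, x) within {0..1} \<times> UNIV)"
      by (auto intro!: derivative_eq_intros)
    from has_derivative_compose[OF this, of g "g' (s *\<^sub>R b + x)"] g
    show "((\<lambda>z. ?k (fst z) (snd z)) has_derivative (\<lambda>h. g' (s *\<^sub>R b + x) (fst h *\<^sub>R b + snd h)))
      (at (s, x) within {0..1} \<times> UNIV)" by simp
  next
    show "continuous_on ({0..1} \<times> UNIV)
        (\<lambda>z. g' (fst z *\<^sub>R b + snd z) (fst h *\<^sub>R b + snd h))" for h
      by (rule continuous_on_compose2[OF cont]) (auto intro!: continuous_intros)
  qed
  \<comment> \<open>Shifts by at most \<open>norm b\<close> require enlarging the ball by that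
    radius.\<close>
  have supp1: "\<forall>s\<in>{0..1}. \<forall>x. M + norm b < norm x \<longrightarrow> ?k s x = 0"
  proof (intro ballI allI impI supp)
    fix s :: real and x :: "real^3" assume that: "s \<in> {0..1}" "M + norm b < norm x"
    have "norm x \<le> norm (s *\<^sub>R b + x) + norm (s *\<^sub>R b)"
      using norm_triangle_ineq4[of "s *\<^sub>R b + x" "s *\<^sub>R b"] by simp
    moreover have "norm (s *\<^sub>R b) \<le> norm b"
      using that(1) by (auto intro: mult_left_le_one_le)
    ultimately show "M < norm (s *\<^sub>R b + x)" using that(2) by linarith
  qed
  note der = has_real_derivative_integral_slab[OF k zero_less_one supp1, of 0]
  show "integrable lborel (\<lambda>x. g' x b)" using der(2) by simp
  have "continuous_on UNIV g" using g by (intro has_derivative_continuous_on) auto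
  then have "((\<lambda>s. LINT x|lborel. g x) has_real_derivative (LINT x|lborel. g' x b)) (at 0 within {0..1})"
    using der(3) by (simp add: integral_lborel_translation)
  moreover have "((\<lambda>s. LINT x|lborel. g x) has_real_derivative 0) (at 0 within {0..1})"
    by (rule DERIV_const)
  ultimately show "(LINT x|lborel. g' x b) = 0"
    unfolding has_real_derivative_iff_has_vector_derivative
    by (rule vector_derivative_unique_within_closed_interval[OF zero_less_one, of 0,
          unfolded cbox_interval, rotated]) simp
qed

text \<open>Each summand of the divergence is a directional derivative of a compactly supported
  component, so it integrates to zero and no boundary term arises.\<close>

lemma integral_dvg_eq_0:
  assumes W: "slab_derivative T W W'" and t: "t \<in> {0..T}"
    and supp: "\<forall>x. M < norm x \<longrightarrow> W t x = 0"
  shows "integrable lborel (dvg (W t))" and "(LINT x|lborel. dvg (W t) x) = 0"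
proof -
  have Wj: "slab_derivative T (\<lambda>t x. W t x $ j) (\<lambda>t x h. W' t x h $ j)" for j
    by (rule slab_derivative_bounded_linear[OF bounded_linear_vec_nth W])
  have cont: "continuous_on UNIV (\<lambda>x. W' t x (0, h) $ j)" for h j
    by (rule slab_derivative_continuous_space[OF Wj t])
  note partial = integral_directional_derivative_eq_0[OF slab_derivative_space[OF Wj t] cont, of M]
  have eq: "dvg (W t) = (\<lambda>x. \<Sum>j\<in>UNIV. W' t x (0, axis j 1) $ j)"
    unfolding dvg_def pd_eq[OF Wj t] ..
  show "integrable lborel (dvg (W t))"
    unfolding eq by (intro Bochner_Integration.integrable_sum partial(1)) (simp add: supp)
  show "(LINT x|lborel. dvg (W t) x) = 0"
    unfolding eq using partial supp
    by (subst Bochner_Integration.integral_sum) (auto intro!: sum.neutral)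
qed

subsection \<open>Differential operators and material derivatives\<close>

text \<open>Expanding \<open>(1, v x)\<close> in the standard basis makes the transport operator a
  single evaluation of the linear derivative. Product rules for it are then those of
  \<open>slab_derivative\<close>.\<close>

lemma material_derivative_eq:
  assumes f: "slab_derivative T f f'" and t: "t \<in> {0..T}" and T: "T > 0"
  shows "dt T f t x + advect v (f t) x = f' t x (1, v x)"
proof -
  note lin = slab_derivative_linear[OF f t, of x]
  have "(1, v x) = (1, 0) + (\<Sum>j\<in>UNIV. (v x $ j) *\<^sub>R (0 :: real, axis j (1 :: real)))"
    using basis_expansion[of "v x"]
    by (simp add: prod_eq_iff fst_sum snd_sum scalar_mult_eq_scaleR)
  then have "f' t x (1, v x) =
      f' t x (1, 0) + (\<Sum>j\<in>UNIV. (v x $ j) *\<^sub>R f' t x (0, axis j 1))"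
    by (simp only: linear_add[OF lin] linear_sum[OF lin] linear_scale[OF lin])
  then show ?thesis
    by (simp add: advect_def dt_eq[OF f t T] pd_eq[OF f t])
qed

lemma grad_vec_nth:
  assumes "slab_derivative T u u'" and "t \<in> {0..T}"
  shows "grad_vec (u t) x $ i $ j = u' t x (0, axis j 1) $ i"
  by (simp add: jacobian_def matrix_def frechet_derivative_at[OF slab_derivative_space[OF assms], symmetric])

lemma inner_grad:
  assumes f: "slab_derivative T f f'" and t: "t \<in> {0..T}"
  shows "v \<bullet> grad (f t) x = f' t x (0, v)"
proof -
  note lin = slab_derivative_linear[OF f t, of x]
  have "(0, v) = (\<Sum>j\<in>UNIV. (v $ j) *\<^sub>R (0 :: real, axis j (1 :: real)))"
    using basis_expansion[of v]
    by (simp add: prod_eq_iff fst_sum snd_sum scalar_mult_eq_scaleR)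
  then have "f' t x (0, v) = (\<Sum>j\<in>UNIV. (v $ j) *\<^sub>R f' t x (0, axis j 1))"
    by (simp only: linear_sum[OF lin] linear_scale[OF lin])
  then show ?thesis by (simp add: inner_vec_def grad_def pd_eq[OF f t])
qed

lemma dvg_scaleR:
  assumes f: "slab_derivative T f f'" and u: "slab_derivative T u u'" and t: "t \<in> {0..T}"
  shows "dvg (\<lambda>y. f t y *\<^sub>R u t y) x = f t x * dvg (u t) x + f' t x (0, u t x)"
proof -
  note uj = slab_derivative_bounded_linear[OF bounded_linear_vec_nth u]
  have "pd j (\<lambda>y. f t y * u t y $ j) x = f t x * u' t x (0, axis j 1) $ j + pd j (f t) x * u t x $ j" for j
    using pd_eq[OF slab_derivative_bounded_bilinear[OF bounded_bilinear_mult f uj] t] pd_eq[OF f t]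
    by simp
  then show ?thesis
    by (simp add: inner_grad[OF f t, symmetric] grad_def inner_vec_def dvg_def pd_eq[OF uj t]
        sum.distrib sum_distrib_left mult.commute)
qed

lemma dvg_diff:
  assumes v: "slab_derivative T v v'" and w: "slab_derivative T w w'" and t: "t \<in> {0..T}"
  shows "dvg (\<lambda>y. v t y - w t y) x = dvg (v t) x - dvg (w t) x"
proof -
  note vj = slab_derivative_bounded_linear[OF bounded_linear_vec_nth v]
  note wj = slab_derivative_bounded_linear[OF bounded_linear_vec_nth w]
  show ?thesis
    using pd_eq[OF slab_derivative_diff[OF vj wj] t]
    by (simp add: dvg_def pd_eq[OF vj t] pd_eq[OF wj t] sum_subtractf)
qed

text \<open>The \<open>j\<close>-th component is the sum of
  \<open>S\<^sub>i\<^sub>j u\<^sub>i\<close> over \<open>i\<close>: differentiating \<open>S\<close>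
  gives the row-wise divergence paired with \<open>u\<close>, differentiating \<open>u\<close> the
  contraction of \<open>S\<close> with the velocity gradient. The transpose makes this valid without
  symmetry of \<open>S\<close>.\<close>

lemma dvg_mat_vec:
  assumes S: "slab_derivative T S S'" and u: "slab_derivative T u u'" and t: "t \<in> {0..T}"
  shows "dvg (\<lambda>y. transpose (S t y) *v u t y) x =
    u t x \<bullet> dvg_mat (S t) x + trace (S t x ** transpose (grad_vec (u t) x))"
proof -
  note ui = slab_derivative_bounded_linear[OF bounded_linear_vec_nth u]
  note Sij = slab_derivative_bounded_linear[OF bounded_linear_vec_nth
      slab_derivative_bounded_linear[OF bounded_linear_vec_nth S]]
  have p: "pd j (\<lambda>y. (transpose (S t y) *v u t y) $ j) x =
      (\<Sum>i\<in>UNIV. S t x $ i $ j * u' t x (0, axis j 1) $ i + S' t x (0, axis j 1) $ i $ j * u t x $ i)" for j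
  proof -
    have "((\<lambda>y. \<Sum>i\<in>UNIV. S t y $ i $ j * u t y $ i) has_derivative
      (\<lambda>h. \<Sum>i\<in>UNIV. S t x $ i $ j * u' t x (0, h) $ i + S' t x (0, h) $ i $ j * u t x $ i)) (at x)"
      by (intro has_derivative_sum has_derivative_mult slab_derivative_space[OF ui t]
          slab_derivative_space[OF Sij t])
    from frechet_derivative_at[OF this, symmetric]
    show ?thesis
      by (simp add: pd_def matrix_vector_mult_def transpose_def)
  qed
  have "u t x \<bullet> dvg_mat (S t) x = (\<Sum>i\<in>UNIV. \<Sum>j\<in>UNIV. S' t x (0, axis j 1) $ i $ j * u t x $ i)"
    by (simp add: inner_vec_def dvg_mat_def dvg_def pd_eq[OF Sij t] sum_distrib_left mult.commute)
  moreover have "trace (S t x ** transpose (grad_vec (u t) x)) =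
      (\<Sum>i\<in>UNIV. \<Sum>j\<in>UNIV. S t x $ i $ j * u' t x (0, axis j 1) $ i)"
    by (simp add: trace_def matrix_matrix_mult_def transpose_def grad_vec_nth[OF u t])
  ultimately show ?thesis
    unfolding dvg_def p sum.distrib
    by (subst sum.swap, subst (2) sum.swap) simp
qed

lemma trace_grad_vec: "slab_derivative T u u' \<Longrightarrow> t \<in> {0..T} \<Longrightarrow> trace (grad_vec (u t) x) = dvg (u t) x"
  by (simp add: trace_def dvg_def grad_vec_nth
      pd_eq[OF slab_derivative_bounded_linear[OF bounded_linear_vec_nth]])

section \<open>The evolution equation of the stress\<close>

lemma slab_derivative_stress:
  assumes \<rho>: "slab_derivative T \<rho> \<rho>'" and A: "slab_derivative T A A'" and F: "slab_derivative T F F'"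
  shows "slab_derivative T (\<lambda>t x. stress G (\<rho> t x) (A t x) (F t x))
     (\<lambda>t x h. (\<rho> t x * G) *\<^sub>R (F t x ** A t x ** transpose (F' t x h) +
          (F t x ** A' t x h + F' t x h ** A t x) ** transpose (F t x)) +
        (\<rho>' t x h * G) *\<^sub>R (F t x ** A t x ** transpose (F t x) - mat 1))"
proof -
  note mm = slab_derivative_bounded_bilinear[OF bounded_bilinear_matrix_mult]
  note FT = slab_derivative_bounded_linear[OF bounded_linear_transpose F]
  show ?thesis
    using slab_derivative_bounded_bilinear[OF bounded_bilinear_scaleR
        slab_derivative_bounded_linear[OF bounded_linear_mult_left[of G] \<rho>]
        slab_derivative_diff[OF mm[OF mm[OF F A] FT] slab_derivative_const[of T "mat 1"]]]
    by (simp add: stress_def)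
qed

lemma matrix_inv_right: "invertible M \<Longrightarrow> M ** matrix_inv M = mat 1"
  unfolding invertible_def matrix_inv_def by (rule conjunct1[OF someI_ex])

text \<open>Pointwise algebra, with \<open>L ** F\<close> and \<open>- r * d\<close> in place of the
  material derivatives of \<open>F\<close> and of the density. The terms in \<open>L\<close> cancel
  except for those coming from \<open>- mat 1\<close>, which form the right-hand side; the terms in
  \<open>d\<close> cancel, and the relaxation of \<open>A\<close> contributes exactly minus the
  stress.\<close>

lemma material_derivative_stress:
  fixes A F A' L :: "real^3^3"
  assumes lam: "lam \<noteq> 0" and F: "invertible F"
    and A': "lam *\<^sub>R A' + A = matrix_inv F ** transpose (matrix_inv F)"
  shows "lam *\<^sub>R ((r * G) *\<^sub>R (F ** A ** transpose (L ** F) + (F ** A' + L ** F ** A) ** transpose F) +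
        (- r * d * G) *\<^sub>R (F ** A ** transpose F - mat 1)
      - L ** stress G r A F - stress G r A F ** transpose L + d *\<^sub>R stress G r A F) + stress G r A F
    = (lam * G * r) *\<^sub>R (L + transpose L)"
proof -
  interpret mm: bounded_bilinear "(**) :: real^3^3 \<Rightarrow> real^3^3 \<Rightarrow> real^3^3"
    by (rule bounded_bilinear_matrix_mult)
  define B where "B = F ** A ** transpose F"
  \<comment> \<open>Multiplying the relaxation equation by \<open>F\<close> and
    \<open>transpose F\<close> turns its right-hand side into the identity.\<close>
  have "F ** (lam *\<^sub>R A' + A) ** transpose F = (F ** matrix_inv F) ** transpose (F ** matrix_inv F)"
    unfolding A' by (simp add: matrix_transpose_mul matrix_mul_assoc)
  then have FA'F: "lam *\<^sub>R (F ** A' ** transpose F) = mat 1 - B"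
    by (simp add: B_def matrix_inv_right[OF F] mm.add_left mm.add_right mm.scaleR_left mm.scaleR_right
        algebra_simps)
  have "F ** A ** transpose (L ** F) = B ** transpose L"
    by (simp add: B_def matrix_transpose_mul matrix_mul_assoc)
  moreover have "(F ** A' + L ** F ** A) ** transpose F = F ** A' ** transpose F + L ** B"
    by (simp add: B_def matrix_mul_assoc mm.add_left)
  moreover have "lam *\<^sub>R (r * G) *\<^sub>R (F ** A' ** transpose F) = (r * G) *\<^sub>R (mat 1 - B)"
    by (simp add: FA'F[symmetric] mult.commute)
  ultimately show ?thesis
    unfolding stress_def B_def[symmetric]
    by (simp add: mm.diff_left mm.diff_right mm.scaleR_left mm.scaleR_right scaleR_add_right
        scaleR_diff_right) (simp add: algebra_simps)
qed

lemma transpose_stress: "transpose A = A \<Longrightarrow> transpose (stress G r A F) = stress G r A F"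
  unfolding stress_def
  by (simp add: transpose_scalar bounded_linear.linear[OF bounded_linear_transpose, THEN linear_diff]
      matrix_transpose_mul matrix_mul_assoc)

subsection \<open>The energy law\<close>

lemma trace_transpose: "trace (transpose M) = trace M"
  by (simp add: trace_def transpose_def)

lemma slab_derivative_pressure:
  fixes \<rho> :: "real \<Rightarrow> real^3 \<Rightarrow> real"
  assumes \<rho>: "slab_derivative T \<rho> \<rho>'" and pos: "\<forall>t\<in>{0..T}. \<forall>x. \<rho> t x > 0"
  shows "slab_derivative T (\<lambda>t x. a * \<rho> t x powr \<gamma>)
    (\<lambda>t x h. a * (\<gamma> * \<rho> t x powr (\<gamma> - 1)) * \<rho>' t x h)"
proof (rule slab_derivative_compose_real[OF \<rho>, of "{0<..}"])
  show "((\<lambda>r. a * r powr \<gamma>) has_real_derivative a * (\<gamma> * r powr (\<gamma> - 1))) (at r)"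
    if "r \<in> {0<..}" for r using that by (auto intro!: derivative_eq_intros)
qed (use pos in \<open>auto intro!: continuous_intros\<close>)

lemma slab_derivative_energy_density:
  assumes \<rho>: "slab_derivative T \<rho> \<rho>'" and u: "slab_derivative T u u'" and S: "slab_derivative T S S'"
    and pos: "\<forall>t\<in>{0..T}. \<forall>x. \<rho> t x > 0"
  shows "slab_derivative T (\<lambda>t x. energy_density lam \<mu>0 a \<gamma> (\<rho> t x) (u t x) (S t x))
    (\<lambda>t x h. \<rho> t x / 2 * (u t x \<bullet> u' t x h + u' t x h \<bullet> u t x) + \<rho>' t x h / 2 * (u t x \<bullet> u t x)
       + (a / (\<gamma> - 1) * (\<gamma> * \<rho> t x powr (\<gamma> - 1) - \<gamma>) + \<mu>0 / lam * ln (\<rho> t x)) * \<rho>' t x h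
       + trace (S' t x h) / 2)"
proof -
  let ?\<phi> = "\<lambda>r. a / (\<gamma> - 1) * (r powr \<gamma> - 1 - \<gamma> * (r - 1)) + \<mu>0 / lam * (r * ln r - r + 1)"
  let ?\<phi>' = "\<lambda>r. a / (\<gamma> - 1) * (\<gamma> * r powr (\<gamma> - 1) - \<gamma>) + \<mu>0 / lam * ln r"
  \<comment> \<open>The coefficients are abstracted to \<open>b\<close> and \<open>c\<close>, which
    keeps the quotients opaque to simplification.\<close>
  have "((\<lambda>r. b * (r powr \<gamma> - 1 - \<gamma> * (r - 1)) + c * (r * ln r - r + 1)) has_real_derivative
      b * (\<gamma> * r powr (\<gamma> - 1) - \<gamma>) + c * ln r) (at r)" if "r \<in> {0<..}" for b c r
    using that by (auto intro!: derivative_eq_intros)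
  then have "(?\<phi> has_real_derivative ?\<phi>' r) (at r)" if "r \<in> {0<..}" for r
    using that .
  moreover have "continuous_on {0<..} (\<lambda>r. b * (\<gamma> * r powr (\<gamma> - 1) - \<gamma>) + c * ln r)" for b c :: real
    by (auto intro!: continuous_intros)
  then have "continuous_on {0<..} ?\<phi>'" .
  ultimately have \<phi>: "slab_derivative T (\<lambda>t x. ?\<phi> (\<rho> t x)) (\<lambda>t x h. ?\<phi>' (\<rho> t x) * \<rho>' t x h)"
    using pos by (intro slab_derivative_compose_real[OF \<rho>, of "{0<..}"]) auto
  have kin: "slab_derivative T (\<lambda>t x. \<rho> t x / 2 * (u t x \<bullet> u t x))
     (\<lambda>t x h. \<rho> t x / 2 * (u t x \<bullet> u' t x h + u' t x h \<bullet> u t x) + \<rho>' t x h / 2 * (u t x \<bullet> u t x))"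
    by (intro slab_derivative_bounded_bilinear[OF bounded_bilinear_mult]
        slab_derivative_bounded_bilinear[OF bounded_bilinear_inner u u]
        slab_derivative_bounded_linear[OF bounded_linear_divide \<rho>])
  have tr: "slab_derivative T (\<lambda>t x. trace (S t x) / 2) (\<lambda>t x h. trace (S' t x h) / 2)"
    by (intro slab_derivative_bounded_linear[OF bounded_linear_divide]
        slab_derivative_bounded_linear[OF bounded_linear_trace S])
  show ?thesis
    using slab_derivative_add[OF slab_derivative_add[OF kin \<phi>] tr]
    by (simp add: energy_density_def power2_norm_eq_inner add.assoc)
qed

text \<open>The energy flux is \<open>(e + p - a - G) u - S u\<close>: the first summand balances the convection of
  the density \<open>e\<close> and the pressure work, where \<open>- a\<close> and \<open>- G\<close> come from the affine parts
  of the two internal energies.\<close>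

lemma energy_balance:
  assumes lam: "lam > 0" and \<gamma>: "\<gamma> > 1" and T: "T > 0" and t: "t \<in> {0..T}"
    and \<rho>: "slab_derivative T \<rho> \<rho>'" and u: "slab_derivative T u u'" and S: "slab_derivative T S S'"
    and pos: "\<forall>t\<in>{0..T}. \<forall>x. \<rho> t x > 0"
    and e_def: "e = (\<lambda>t x. energy_density lam \<mu>0 a \<gamma> (\<rho> t x) (u t x) (S t x))"
    and sym: "transpose (S t x) = S t x"
    and mass: "\<rho>' t x (1, u t x) = - \<rho> t x * dvg (u t) x"
    and mom: "\<rho> t x *\<^sub>R u' t x (1, u t x) + grad (\<lambda>y. a * \<rho> t y powr \<gamma>) x = dvg_mat (S t) x"
    and str: "lam *\<^sub>R (S' t x (1, u t x) - grad_vec (u t) x ** S t x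
                   - S t x ** transpose (grad_vec (u t) x) + dvg (u t) x *\<^sub>R S t x) + S t x
             = (\<mu>0 * \<rho> t x) *\<^sub>R (grad_vec (u t) x + transpose (grad_vec (u t) x))"
  shows "dt T e t x + dvg (\<lambda>y. (e t y + (a * \<rho> t y powr \<gamma> - a - \<mu>0 / lam)) *\<^sub>R u t y
      - transpose (S t y) *v u t y) x = - (1 / lam) * (trace (S t x) / 2)"
proof -
  interpret tr: bounded_linear "trace :: real^3^3 \<Rightarrow> real" by (rule bounded_linear_trace)
  \<comment> \<open>Naming all scalars that occur turns the claim into an identity between real
    numbers.\<close>
  define r d g P n L Q where "r = \<rho> t x" and "d = dvg (u t) x" and "g = \<rho>' t x (0, u t x)"
    and "P = r powr (\<gamma> - 1)" and "n = u t x \<bullet> u t x"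
    and "L = trace (S t x ** transpose (grad_vec (u t) x))" and "Q = u t x \<bullet> dvg_mat (S t) x"
  have r: "r > 0" using pos t by (simp add: r_def)
  have rP: "r powr \<gamma> = r * P"
    using r by (simp add: P_def powr_diff)
  \<comment> \<open>The derivative is made explicit only in the direction \<open>(1, u t x)\<close>,
    where the mass equation eliminates the derivative of the density.\<close>
  obtain e' where e: "slab_derivative T e e'"
    and e': "e' t x (1, u t x) = r * (u t x \<bullet> u' t x (1, u t x)) - r * d / 2 * n
       - (a / (\<gamma> - 1) * (\<gamma> * P - \<gamma>) + \<mu>0 / lam * ln r) * r * d + trace (S' t x (1, u t x)) / 2"
  proof
    show "slab_derivative T e (\<lambda>t x h. \<rho> t x / 2 * (u t x \<bullet> u' t x h + u' t x h \<bullet> u t x) + \<rho>' t x h / 2 * (u t x \<bullet> u t x)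
       + (a / (\<gamma> - 1) * (\<gamma> * \<rho> t x powr (\<gamma> - 1) - \<gamma>) + \<mu>0 / lam * ln (\<rho> t x)) * \<rho>' t x h
       + trace (S' t x h) / 2)"
      unfolding e_def by (rule slab_derivative_energy_density[OF \<rho> u S pos])
  qed (simp add: mass r_def d_def P_def n_def inner_commute)
  note p = slab_derivative_pressure[OF \<rho> pos, of a \<gamma>]
  note c = slab_derivative_add[OF e slab_derivative_diff[OF slab_derivative_diff[OF p
        slab_derivative_const[of T a]] slab_derivative_const[of T "\<mu>0 / lam"]]]
  note flux1 = slab_derivative_bounded_bilinear[OF bounded_bilinear_scaleR c u]
  note flux2 = slab_derivative_bounded_bilinear[OF bounded_bilinear_matrix_vector_mult
      slab_derivative_bounded_linear[OF bounded_linear_transpose S] u]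
  have "dvg (\<lambda>y. (e t y + (a * \<rho> t y powr \<gamma> - a - \<mu>0 / lam)) *\<^sub>R u t y
      - transpose (S t y) *v u t y) x =
      (e t x + (a * (r * P) - a - \<mu>0 / lam)) * d + (e' t x (0, u t x) + a * (\<gamma> * P) * g) - (Q + L)"
    unfolding dvg_diff[OF flux1 flux2 t] dvg_scaleR[OF c u t] dvg_mat_vec[OF S u t]
    by (simp add: r_def[symmetric] rP) (simp add: r_def d_def g_def P_def L_def Q_def)
  \<comment> \<open>The time derivative and the convective part of the flux combine into the
    material derivative.\<close>
  moreover have "e' t x (1, 0) + e' t x (0, u t x) = e' t x (1, u t x)"
    using linear_add[OF slab_derivative_linear[OF e t], of x "(1, 0)" "(0, u t x)"] by simp
  \<comment> \<open>This is the momentum equation tested with \<open>u\<close>; the pressure work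
    \<open>a * (\<gamma> * P) * g\<close> also occurs in the flux.\<close>
  moreover have "r * (u t x \<bullet> u' t x (1, u t x)) + a * (\<gamma> * P) * g = Q"
    using arg_cong[OF mom, of "\<lambda>v. u t x \<bullet> v"] inner_grad[OF p t]
    by (simp add: inner_add_right r_def P_def g_def Q_def)
  \<comment> \<open>Symmetry of \<open>S\<close> makes both stretching terms have the same trace, so
    half the trace contributes one \<open>L\<close>, which the flux cancels.\<close>
  moreover have "trace (grad_vec (u t) x ** S t x) = L"
    using trace_transpose[of "grad_vec (u t) x ** S t x"]
    by (simp add: L_def matrix_transpose_mul sym)
  then have "lam * (trace (S' t x (1, u t x)) - 2 * L + d * trace (S t x)) + trace (S t x) = 2 * \<mu>0 * r * d"
    using arg_cong[OF str, of trace]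
    by (simp add: tr.add tr.diff tr.scaleR trace_transpose trace_grad_vec[OF u t] L_def[symmetric]
        d_def[symmetric] r_def[symmetric])
  then have "trace (S' t x (1, u t x)) / 2 = L - d * trace (S t x) / 2 - 1 / lam * (trace (S t x) / 2) + \<mu>0 / lam * r * d"
    using lam by (simp add: field_simps)
  moreover have "e t x = r / 2 * n + a / (\<gamma> - 1) * (r * P - 1 - \<gamma> * (r - 1)) + \<mu>0 / lam * (r * ln r - r + 1)
     + trace (S t x) / 2"
    by (simp add: e_def energy_density_def r_def[symmetric] rP n_def power2_norm_eq_inner)
  \<comment> \<open>With \<open>h\<close> the pressure potential this is
    \<open>p = r h' - h + a\<close>. Taking \<open>b = a / (\<gamma> - 1)\<close> confines the
    division by \<open>\<gamma> - 1\<close> to one place.\<close>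
  moreover have "b * (\<gamma> - 1) * (r * P) =
      b * (\<gamma> * P - \<gamma>) * r - b * (r * P - 1 - \<gamma> * (r - 1)) + b * (\<gamma> - 1)" for b
    by (simp add: algebra_simps)
  from this[of "a / (\<gamma> - 1)"]
  have "a * (r * P) =
      a / (\<gamma> - 1) * (\<gamma> * P - \<gamma>) * r - a / (\<gamma> - 1) * (r * P - 1 - \<gamma> * (r - 1)) + a"
    using \<gamma> by simp
  ultimately show ?thesis
    unfolding dt_eq[OF e t T] using e' by (simp only:) (simp add: algebra_simps)
qed

text \<open>Integrability is asserted alongside the identity because the integral of a
  non-integrable function is 0 by convention; likewise \<open>D\<close> is a derivative shown to
  exist, one-sided at the ends.\<close>

theorem lemma3p1:
  fixes lam \<mu>0 a \<gamma> G T R \<sigma> :: real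
    and \<rho> :: "real \<Rightarrow> real^3 \<Rightarrow> real" and u :: "real \<Rightarrow> real^3 \<Rightarrow> real^3"
    and A F S :: "real \<Rightarrow> real^3 \<Rightarrow> real^3^3"
    and \<rho>0 :: "real^3 \<Rightarrow> real" and u0 :: "real^3 \<Rightarrow> real^3" and A0 F0 :: "real^3 \<Rightarrow> real^3^3"
  assumes "lam > 0" and "\<mu>0 > 0" and "a > 0" and "\<gamma> > 1" and G: "G = \<mu>0 / lam"
    and "T > 0" and "R > 0" and "\<sigma> > 0"
    and sol: "solution lam \<mu>0 a \<gamma> T \<rho> u A F"
    and init: "\<rho> 0 = \<rho>0" "u 0 = u0" "A 0 = A0" "F 0 = F0"
    and data0: "initial_data_assms G R \<rho>0 u0 A0 F0"
    and speed: "finite_propagation R \<sigma> T \<rho> u A F"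
    and S: "S = (\<lambda>t x. stress G (\<rho> t x) (A t x) (F t x))"
  shows "(\<forall>t\<in>{0..T}. \<forall>x.
           lam *\<^sub>R (dt T S t x + advect (u t) (S t) x - grad_vec (u t) x ** S t x
                   - S t x ** transpose (grad_vec (u t) x) + dvg (u t) x *\<^sub>R S t x) + S t x
             = (\<mu>0 * \<rho> t x) *\<^sub>R (grad_vec (u t) x + transpose (grad_vec (u t) x))) \<and>
         (\<forall>t\<in>{0..T}.
           integrable lborel (\<lambda>x. energy_density lam \<mu>0 a \<gamma> (\<rho> t x) (u t x) (S t x)) \<and>
           integrable lborel (\<lambda>x. trace (S t x) / 2) \<and>
           (\<exists>D. ((\<lambda>s. LINT x|lborel. energy_density lam \<mu>0 a \<gamma> (\<rho> s x) (u s x) (S s x))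
                   has_real_derivative D) (at t within {0..T}) \<and>
                D + 1 / lam * (LINT x|lborel. trace (S t x) / 2) = 0))"
proof -
  obtain \<rho>' u' A' F' where
    \<rho>: "slab_derivative T \<rho> \<rho>'" and u: "slab_derivative T u u'" and
    A: "slab_derivative T A A'" and F: "slab_derivative T F F'"
    using sol unfolding solution_def by (metis C1_slab_obtain)
  have pos: "\<forall>t\<in>{0..T}. \<forall>x. \<rho> t x > 0"
    using sol unfolding solution_def by blast
  have A_sym: "transpose (A t x) = A t x" and F_inv: "invertible (F t x)"
    if "t \<in> {0..T}" for t x
    using sol that unfolding solution_def sym_pos_def_def by auto
  obtain S' where S': "slab_derivative T S S'" and
    S'_eq: "\<And>t x h. S' t x h = (\<rho> t x * G) *\<^sub>R (F t x ** A t x ** transpose (F' t x h) +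
          (F t x ** A' t x h + F' t x h ** A t x) ** transpose (F t x)) +
        (\<rho>' t x h * G) *\<^sub>R (F t x ** A t x ** transpose (F t x) - mat 1)"
    using slab_derivative_stress[OF \<rho> A F, of G, folded S] by blast
  \<comment> \<open>The product rule splits the divergence of the mass flux; its convective part
    joins the time derivative.\<close>
  have mass: "\<rho>' t x (1, u t x) = - \<rho> t x * dvg (u t) x" if t: "t \<in> {0..T}" for t x
  proof -
    have "dt T \<rho> t x + dvg (\<lambda>y. \<rho> t y *\<^sub>R u t y) x = 0"
      using sol t unfolding solution_def by blast
    then show ?thesis
      using linear_add[OF slab_derivative_linear[OF \<rho> t], of x "(1, 0)" "(0, u t x)"]
      by (simp add: dt_eq[OF \<rho> t \<open>T > 0\<close>] dvg_scaleR[OF \<rho> u t])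
  qed
  have mom: "\<rho> t x *\<^sub>R u' t x (1, u t x) + grad (\<lambda>y. a * \<rho> t y powr \<gamma>) x = dvg_mat (S t) x"
    if t: "t \<in> {0..T}" for t x
  proof -
    have "\<rho> t x *\<^sub>R dt T u t x + \<rho> t x *\<^sub>R advect (u t) (u t) x + grad (\<lambda>y. a * \<rho> t y powr \<gamma>) x
          = dvg_mat (S t) x"
      using sol t unfolding solution_def S G by blast
    then show ?thesis
      by (simp add: material_derivative_eq[OF u t \<open>T > 0\<close>, symmetric] scaleR_add_right)
  qed
  have A'_eq: "lam *\<^sub>R A' t x (1, u t x) + A t x = matrix_inv (F t x) ** transpose (matrix_inv (F t x))"
    and F'_eq: "F' t x (1, u t x) = grad_vec (u t) x ** F t x" if t: "t \<in> {0..T}" for t x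
    using sol t unfolding solution_def
    by (simp_all add: material_derivative_eq[OF A t \<open>T > 0\<close>, symmetric]
        material_derivative_eq[OF F t \<open>T > 0\<close>, symmetric])
  \<comment> \<open>The equations for the density and for \<open>F\<close> give the derivatives
    assumed in \<open>material_derivative_stress\<close>, with \<open>L\<close> the velocity
    gradient and \<open>d\<close> its trace.\<close>
  have str: "lam *\<^sub>R (S' t x (1, u t x) - grad_vec (u t) x ** S t x
                   - S t x ** transpose (grad_vec (u t) x) + dvg (u t) x *\<^sub>R S t x) + S t x
             = (\<mu>0 * \<rho> t x) *\<^sub>R (grad_vec (u t) x + transpose (grad_vec (u t) x))"
    if t: "t \<in> {0..T}" for t x
    using material_derivative_stress[OF _ F_inv[OF t] A'_eq[OF t], where r = "\<rho> t x" and G = G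
        and L = "grad_vec (u t) x" and d = "dvg (u t) x"] \<open>lam > 0\<close>
    unfolding S'_eq F'_eq[OF t] mass[OF t] S by (simp add: G)
  have S_sym: "transpose (S t x) = S t x" if "t \<in> {0..T}" for t x
    unfolding S using A_sym[OF that] by (rule transpose_stress)

  define e where "e = (\<lambda>t x. energy_density lam \<mu>0 a \<gamma> (\<rho> t x) (u t x) (S t x))"
  define W where "W = (\<lambda>t x. (e t x + (a * \<rho> t x powr \<gamma> - a - \<mu>0 / lam)) *\<^sub>R u t x - transpose (S t x) *v u t x)"
  note e' = slab_derivative_energy_density[OF \<rho> u S' pos, of lam \<mu>0 a \<gamma>, folded e_def]
  note p = slab_derivative_pressure[OF \<rho> pos, of a \<gamma>]
  note W' = slab_derivative_diff[OF
      slab_derivative_bounded_bilinear[OF bounded_bilinear_scaleR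
        slab_derivative_add[OF e' slab_derivative_diff[OF slab_derivative_diff[OF p
          slab_derivative_const[of T a]] slab_derivative_const[of T "\<mu>0 / lam"]]] u]
      slab_derivative_bounded_bilinear[OF bounded_bilinear_matrix_vector_mult
        slab_derivative_bounded_linear[OF bounded_linear_transpose S'] u], folded W_def]
  have balance: "dt T e t x + dvg (W t) x = - (1 / lam) * (trace (S t x) / 2)"
    if t: "t \<in> {0..T}" for t x
    unfolding W_def
    by (rule energy_balance[OF \<open>lam > 0\<close> \<open>\<gamma> > 1\<close> \<open>T > 0\<close> t \<rho> u S' pos e_def S_sym[OF t]
          mass[OF t] mom[OF t] str[OF t]])

  \<comment> \<open>The ball reached at the final time contains the supports at all times.\<close>
  define M where "M = R + \<sigma> * T"
  have supp: "\<rho> t x = 1 \<and> u t x = 0 \<and> S t x = 0" if "t \<in> {0..T}" "M < norm x" for t x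
  proof -
    have "R + \<sigma> * t \<le> M" using that(1) \<open>\<sigma> > 0\<close> by (simp add: M_def)
    then have "(\<rho> t x - 1, u t x, A t x - mat 1, F t x - mat 1) = 0"
      using speed that unfolding finite_propagation_def by force
    then show ?thesis by (simp add: S stress_def zero_prod_def)
  qed
  \<comment> \<open>The affine terms in the energy density make it vanish at the state
    \<open>\<rho> = 1\<close>, \<open>u = 0\<close>, \<open>S = 0\<close>; the flux vanishes with
    \<open>u\<close>.\<close>
  have e_supp: "\<forall>t\<in>{0..T}. \<forall>x. M < norm x \<longrightarrow> e t x = 0"
    and tr_supp: "\<forall>t\<in>{0..T}. \<forall>x. M < norm x \<longrightarrow> trace (S t x) / 2 = 0"
    and W_supp: "\<forall>t\<in>{0..T}. \<forall>x. M < norm x \<longrightarrow> W t x = 0"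
    using supp by (simp_all add: e_def W_def energy_density_def trace_def)

  show ?thesis
  proof (intro conjI ballI allI)
    fix t x assume t: "t \<in> {0..T}"
    show "lam *\<^sub>R (dt T S t x + advect (u t) (S t) x - grad_vec (u t) x ** S t x
                   - S t x ** transpose (grad_vec (u t) x) + dvg (u t) x *\<^sub>R S t x) + S t x
             = (\<mu>0 * \<rho> t x) *\<^sub>R (grad_vec (u t) x + transpose (grad_vec (u t) x))"
      unfolding material_derivative_eq[OF S' t \<open>T > 0\<close>] by (rule str[OF t])
  next
    fix t assume t: "t \<in> {0..T}"
    note de = has_real_derivative_integral_slab[OF e' \<open>T > 0\<close> e_supp t, folded dt_eq[OF e' t \<open>T > 0\<close>]]
    show "integrable lborel (\<lambda>x. energy_density lam \<mu>0 a \<gamma> (\<rho> t x) (u t x) (S t x))"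
      using de(1) by (simp add: e_def)
    show tr_int: "integrable lborel (\<lambda>x. trace (S t x) / 2)"
      using slab_derivative_bounded_linear[OF bounded_linear_divide
        slab_derivative_bounded_linear[OF bounded_linear_trace S']] \<open>T > 0\<close> tr_supp t
      by (rule has_real_derivative_integral_slab(1))
    note div = integral_dvg_eq_0[OF W' t bspec[OF W_supp t]]
    \<comment> \<open>Integrating the pointwise law leaves only the dissipation, since the
      divergence has integral zero.\<close>
    have "(LINT x|lborel. dt T e t x) = (LINT x|lborel. - (1 / lam) * (trace (S t x) / 2) - dvg (W t) x)"
      by (rule Bochner_Integration.integral_cong) (use balance[OF t] in \<open>auto simp: algebra_simps\<close>)
    also have "\<dots> = - (1 / lam) * (LINT x|lborel. trace (S t x) / 2)"
      by (simp only: Bochner_Integration.integral_diff[OF integrable_mult_right[OF tr_int] div(1)]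
          integral_mult_right_zero div(2) diff_zero)
    finally show "\<exists>D. ((\<lambda>s. LINT x|lborel. energy_density lam \<mu>0 a \<gamma> (\<rho> s x) (u s x) (S s x))
                   has_real_derivative D) (at t within {0..T}) \<and>
                D + 1 / lam * (LINT x|lborel. trace (S t x) / 2) = 0"
      using de(3) unfolding e_def by (intro exI conjI) (assumption, simp)
  qed
qed

end
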